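(* Let $w:\mathbb{Q}\cap(0,1)\to\mathbb{R}_{\ge 0}$ be a nontrivial weight function, and let $R^w$ be a scoring rule parameterized by $w$. Then for every $s\in(0,1)$, $$\mathrm{FVR}(R^w,s)=\frac{\rho}{\rho+\varphi_s},$$ where $\rho:=\sup_{f\in\mathbb{Q}\cap(0,1)}(1-f)\cdot w(f)$ and $\varphi_s:=\inf_{f\in\mathbb{Q}\cap(0,1),\ f\ge s} f\cdot w(f)$; if $\rho=\infty$, the ratio is defined to be $1$. Further, if $w$ is nondecreasing, then for every $s\in\mathbb{Q}\cap(0,1)$ we have $\varphi_s=s\cdot w(s)$ and the formula simplifies to $$\mathrm{FVR}(R^w,s)=\frac{\rho}{\rho+s\cdot w(s)}$$ (again read as $1$ if $\rho=\infty$).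
   Context: An (approval) instance consists of a finite non-empty set $N$ of $n$ voters, a finite non-empty set $M$ of $m$ candidates, and an approval set $A_i\subseteq M$ for each voter $i\in N$. For a candidate $a$, $N_a=\{i\in N\mid a\in A_i\}$ is the set of voters approving $a$. A single-winner rule $R$ selects, for every instance (for all $n$ and $m$), a single candidate in $M$. For a voter $i$, let $f_i=|A_i|/m$; for $s\in(0,1)$, voter $i$ is $s$-flexible if $f_i\ge s$. For a rule $R$ and $s\in(0,1)$, $\mathrm{FVR}(R,s)$ is the smallest $r\in[0,1]$ such that for every instance (over all $n$, $m$ and all approval sets), whenever a group of strictly more than $rn$ voters are all $s$-flexible, at least one voter in the group approves the candidate chosen by $R$ on that instance. (This minimum always exists.) A weight function is a function $w:\mathbb{Q}\cap(0,1)\to\mathbb{R}_{\ge0}$, with the convention $w(1)=0$; it is nontrivial if $w(f)>0$ for some $f\in\mathbb{Q}\cap(0,1)$. The $w$-score of a candidate $a$ is $\sum_{i\in N_a}w(f_i)$. A rule is parameterized by $w$ if on every instance it picks a candidate maximizing the $w$-score (with arbitrary tie-breaking); $R^w$ denotes any such rule. *)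

theory Defs
  imports "HOL-Library.Extended_Real" "HOL-Library.Infinite_Typeclass"
begin

(* An instance is a triple N, M, A of voters, candidates and approval sets. The profile A is a
   total function; fixing its junk values outside N makes the triple determine the instance and
   vice versa, so that a rule can only depend on the instance. *)
definition approval_instance :: "'v set \<Rightarrow> 'c set \<Rightarrow> ('v \<Rightarrow> 'c set) \<Rightarrow> bool" where
  "approval_instance N M A \<longleftrightarrow>
     finite N \<and> N \<noteq> {} \<and> finite M \<and> M \<noteq> {} \<and>
     (\<forall>i\<in>N. A i \<subseteq> M) \<and> (\<forall>i. i \<notin> N \<longrightarrow> A i = {})"

definition supporters :: "'v set \<Rightarrow> ('v \<Rightarrow> 'c set) \<Rightarrow> 'c \<Rightarrow> 'v set" where
  "supporters N A a = {i \<in> N. a \<in> A i}"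

definition flexibility :: "'c set \<Rightarrow> ('v \<Rightarrow> 'c set) \<Rightarrow> 'v \<Rightarrow> rat" where
  "flexibility M A i = of_nat (card (A i)) / of_nat (card M)"

definition flexible :: "'c set \<Rightarrow> ('v \<Rightarrow> 'c set) \<Rightarrow> real \<Rightarrow> 'v \<Rightarrow> bool" where
  "flexible M A s i \<longleftrightarrow> of_rat (flexibility M A i) \<ge> s"

(* The universes of voters and of candidates are arbitrary infinite types, so that
   instances of all sizes n and m occur. *)
type_synonym ('v, 'c) rule = "'v set \<Rightarrow> 'c set \<Rightarrow> ('v \<Rightarrow> 'c set) \<Rightarrow> 'c"

definition single_winner_rule :: "('v::infinite, 'c::infinite) rule \<Rightarrow> bool" where
  "single_winner_rule R \<longleftrightarrow> (\<forall>N M A. approval_instance N M A \<longrightarrow> R N M A \<in> M)"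

definition guarantees_representation ::
  "('v::infinite, 'c::infinite) rule \<Rightarrow> real \<Rightarrow> real \<Rightarrow> bool" where
  "guarantees_representation R s r \<longleftrightarrow>
     (\<forall>N M A G. approval_instance N M A \<longrightarrow> G \<subseteq> N \<longrightarrow>
        real (card G) > r * real (card N) \<longrightarrow> (\<forall>i\<in>G. flexible M A s i) \<longrightarrow>
        (\<exists>i\<in>G. R N M A \<in> A i))"

definition FVR :: "('v::infinite, 'c::infinite) rule \<Rightarrow> real \<Rightarrow> real" where
  "FVR R s = (LEAST r. 0 \<le> r \<and> r \<le> 1 \<and> guarantees_representation R s r)"

(* The minimum in the definition of FVR is always attained. *)
lemma FVR_minimum:
  fixes R :: "('v::infinite, 'c::infinite) rule"
  shows "0 \<le> FVR R s \<and> FVR R s \<le> 1 \<and> guarantees_representation R s (FVR R s)"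
    and "0 \<le> r \<Longrightarrow> r \<le> 1 \<Longrightarrow> guarantees_representation R s r \<Longrightarrow> FVR R s \<le> r"
proof -
  define X where "X = {r. 0 \<le> r \<and> r \<le> 1 \<and> guarantees_representation R s r}"
  have one: "1 \<in> X"
    unfolding X_def guarantees_representation_def approval_instance_def
    by (auto dest: card_mono)
  have bdd: "bdd_below X"
    unfolding X_def by (rule bdd_belowI[of _ 0]) auto
  have "guarantees_representation R s (Inf X)"
    unfolding guarantees_representation_def
  proof (intro allI impI)
    fix N :: "'v set" and M :: "'c set" and A G
    assume inst: "approval_instance N M A" and G: "G \<subseteq> N"
      "real (card G) > Inf X * real (card N)" "\<forall>i\<in>G. flexible M A s i"
    have n: "card N > 0" using inst by (auto simp: approval_instance_def card_gt_0_iff)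
    have "Inf X < real (card G) / real (card N)" using G(2) n by (simp add: field_simps)
    then obtain r where "r \<in> X" "r < real (card G) / real (card N)"
      using cInf_lessD[of X] one by auto
    then show "\<exists>i\<in>G. R N M A \<in> A i"
      using inst G n unfolding X_def guarantees_representation_def by (auto simp: field_simps)
  qed
  moreover have "0 \<le> Inf X" using one by (intro cInf_greatest) (auto simp: X_def)
  moreover have "Inf X \<le> 1" using cInf_lower[OF one bdd] .
  ultimately have ex: "0 \<le> Inf X \<and> Inf X \<le> 1 \<and> guarantees_representation R s (Inf X)" by simp
  have low: "Inf X \<le> r" if "0 \<le> r \<and> r \<le> 1 \<and> guarantees_representation R s r" for r
    using that bdd by (intro cInf_lower) (auto simp: X_def)
  have "FVR R s = Inf X"
    unfolding FVR_def by (rule Least_equality) (use ex low in auto)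
  then show "0 \<le> FVR R s \<and> FVR R s \<le> 1 \<and> guarantees_representation R s (FVR R s)"
    and "0 \<le> r \<Longrightarrow> r \<le> 1 \<Longrightarrow> guarantees_representation R s r \<Longrightarrow> FVR R s \<le> r"
    using ex low by auto
qed

(* A weight function lives on the rationals in (0,1), extended by w 1 = 0. Other values of w
   play no role: an approver of some candidate has flexibility in (0,1]. *)
definition weight_function :: "(rat \<Rightarrow> real) \<Rightarrow> bool" where
  "weight_function w \<longleftrightarrow> (\<forall>f\<in>{0<..<1}. w f \<ge> 0) \<and> w 1 = 0"

definition nontrivial :: "(rat \<Rightarrow> real) \<Rightarrow> bool" where
  "nontrivial w \<longleftrightarrow> (\<exists>f\<in>{0<..<1}. w f > 0)"

definition score ::
  "(rat \<Rightarrow> real) \<Rightarrow> 'v set \<Rightarrow> 'c set \<Rightarrow> ('v \<Rightarrow> 'c set) \<Rightarrow> 'c \<Rightarrow> real" where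
  "score w N M A a = (\<Sum>i\<in>supporters N A a. w (flexibility M A i))"

definition parameterized_by :: "('v::infinite, 'c::infinite) rule \<Rightarrow> (rat \<Rightarrow> real) \<Rightarrow> bool" where
  "parameterized_by R w \<longleftrightarrow> single_winner_rule R \<and>
     (\<forall>N M A. approval_instance N M A \<longrightarrow>
        (\<forall>b\<in>M. score w N M A b \<le> score w N M A (R N M A)))"

definition rho :: "(rat \<Rightarrow> real) \<Rightarrow> ereal" where
  "rho w = (SUP f\<in>{0<..<1}. ereal ((1 - of_rat f) * w f))"

definition phi :: "(rat \<Rightarrow> real) \<Rightarrow> real \<Rightarrow> ereal" where
  "phi w s = (INF f\<in>{f\<in>{0<..<1}. of_rat f \<ge> s}. ereal (of_rat f * w f))"

definition ratio :: "ereal \<Rightarrow> ereal \<Rightarrow> ereal" where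
  "ratio p x = (if p = \<infinity> then 1 else p / (p + x))"

end

theory Submission
  imports Defs
begin

(* Upper bound: if nobody in an s-flexible group G approves the winner, compare the score of the
   winner with the average score of all candidates. A voter of flexibility f contributes f * w f
   to the average; an approver of the winner contributes w f to the winner. Hence the approvers,
   all outside G, satisfy card G * phi \<le> (n - card G) * rho.

   Lower bound: fix flexibilities f and g \<ge> s, and a candidate c approved by every voter of
   flexibility f and by no voter of flexibility g. All other approvals are spread evenly over
   the remaining candidates by cyclic shifts. The averaging estimate is then exact, and c wins
   whenever the voters of flexibility f are more numerous than the proportion at which
   equality holds. *)

section \<open>Averaging the scores, for the upper bound\<close>

lemma sum_score:
  assumes "approval_instance N M A"
  shows "(\<Sum>a\<in>M. score w N M A a)
    = real (card M) * (\<Sum>i\<in>N. of_rat (flexibility M A i) * w (flexibility M A i))"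
proof -
  have fin: "finite N" "finite M" and M: "card M > 0" and sub: "\<And>i. i \<in> N \<Longrightarrow> A i \<subseteq> M"
    using assms by (auto simp: approval_instance_def card_gt_0_iff)
  have "(\<Sum>a\<in>M. score w N M A a)
      = (\<Sum>a\<in>M. \<Sum>i\<in>N. if a \<in> A i then w (flexibility M A i) else 0)"
    unfolding score_def supporters_def by (simp add: sum.If_cases fin Int_def)
  \<comment> \<open>Double counting: a voter adds the same weight to each of the
    \<open>card (A i)\<close> approved candidates.\<close>
  also have "\<dots> = (\<Sum>i\<in>N. \<Sum>a\<in>M. if a \<in> A i then w (flexibility M A i) else 0)"
    by (rule sum.swap)
  also have "\<dots> = (\<Sum>i\<in>N. real (card (A i)) * w (flexibility M A i))"
  proof (rule sum.cong)
    fix i assume "i \<in> N"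
    then have "M \<inter> A i = A i" using sub by auto
    then show "(\<Sum>a\<in>M. if a \<in> A i then w (flexibility M A i) else 0)
        = real (card (A i)) * w (flexibility M A i)"
      by (simp add: sum.If_cases fin)
  qed simp
  also have "\<dots> = (\<Sum>i\<in>N. real (card M) * (of_rat (flexibility M A i) * w (flexibility M A i)))"
    using M by (intro sum.cong) (auto simp: flexibility_def of_rat_divide)
  finally show ?thesis by (simp add: sum_distrib_left)
qed

lemma flexibility_bounds:
  assumes "approval_instance N M A" "i \<in> N"
  shows "0 \<le> flexibility M A i" "flexibility M A i \<le> 1"
    and "a \<in> A i \<Longrightarrow> 0 < flexibility M A i"
    and "a \<in> M \<Longrightarrow> a \<notin> A i \<Longrightarrow> flexibility M A i < 1"
proof -
  have fin: "finite M" and M: "card M > 0" and sub: "A i \<subseteq> M"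
    using assms by (auto simp: approval_instance_def card_gt_0_iff)
  show "0 \<le> flexibility M A i" by (simp add: flexibility_def)
  show "flexibility M A i \<le> 1"
    using M card_mono[OF fin sub] by (simp add: flexibility_def)
  show "0 < flexibility M A i" if "a \<in> A i"
  proof -
    have "0 < card (A i)" using that finite_subset[OF sub fin] by (auto simp: card_gt_0_iff)
    then show ?thesis using M by (simp add: flexibility_def)
  qed
  show "flexibility M A i < 1" if "a \<in> M" "a \<notin> A i"
  proof -
    have "card (A i) < card M" using that sub by (intro psubset_card_mono fin) auto
    then show ?thesis using M by (simp add: flexibility_def)
  qed
qed

text \<open>\<open>P\<close> and \<open>F\<close> are real bounds, later instantiated with the
  finite values of \<open>rho w\<close> and \<open>phi w s\<close>; this keeps the estimate free of
  extended reals.\<close>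

lemma unrepresented_group_bound:
  fixes R :: "('v::infinite, 'c::infinite) rule"
  assumes w: "weight_function w" and R: "parameterized_by R w"
    and inst: "approval_instance N M A" and G: "G \<subseteq> N"
    and flex: "\<forall>i\<in>G. flexible M A s i" and un: "\<forall>i\<in>G. R N M A \<notin> A i"
    and s: "0 < s"
    and P: "\<And>f. 0 < f \<Longrightarrow> f < 1 \<Longrightarrow> (1 - of_rat f) * w f \<le> P" "0 \<le> P"
    and F: "\<And>f. 0 < f \<Longrightarrow> f < 1 \<Longrightarrow> s \<le> of_rat f \<Longrightarrow> F \<le> of_rat f * w f"
  shows "real (card G) * F \<le> (real (card N) - real (card G)) * P"
proof -
  let ?f = "flexibility M A" and ?c = "R N M A"
  define W where "W = supporters N A ?c"
  have fin: "finite N" "finite M" and M: "card M > 0"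
    using inst by (auto simp: approval_instance_def card_gt_0_iff)
  have c: "?c \<in> M" and best: "\<And>b. b \<in> M \<Longrightarrow> score w N M A b \<le> score w N M A ?c"
    using R inst by (auto simp: parameterized_by_def single_winner_rule_def)
  have W: "W \<subseteq> N - G" using un by (auto simp: W_def supporters_def)
  have finG: "finite G" "finite W" using G W fin by (auto intro: finite_subset)
  \<comment> \<open>The end points need care: \<open>w 0\<close> is arbitrary but is multiplied by
    0, and at flexibility 1 the convention \<open>w 1 = 0\<close> applies.\<close>
  have nn: "0 \<le> of_rat (?f i) * w (?f i)" if i: "i \<in> N" for i
  proof -
    consider "?f i = 0" | "?f i = 1" | "0 < ?f i" "?f i < 1"
      using flexibility_bounds(1,2)[OF inst i] by fastforce
    then show ?thesis using w by cases (auto simp: weight_function_def)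
  qed
  \<comment> \<open>Members of \<open>G\<close> miss the winner, so their flexibility is below 1 and
    the hypothesis on \<open>F\<close> covers them.\<close>
  have gF: "F \<le> of_rat (?f i) * w (?f i)" if "i \<in> G" for i
  proof (rule F)
    show "s \<le> of_rat (?f i)" using flex that by (auto simp: flexible_def)
    then have "(0::real) < of_rat (?f i)" using s by linarith
    then show "0 < ?f i" by simp
    show "?f i < 1" using flexibility_bounds(4)[OF inst _ c] that G un by auto
  qed
  \<comment> \<open>Approvers have positive flexibility; at flexibility 1 the left side vanishes and
    \<open>0 \<le> P\<close> suffices.\<close>
  have wP: "(1 - of_rat (?f i)) * w (?f i) \<le> P" if "i \<in> W" for i
  proof -
    have i: "i \<in> N" "?c \<in> A i" using that by (auto simp: W_def supporters_def)
    then consider "?f i = 1" | "0 < ?f i" "?f i < 1"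
      using flexibility_bounds(2)[OF inst i(1)] flexibility_bounds(3)[OF inst i] by fastforce
    then show ?thesis by cases (use P in auto)
  qed
  \<comment> \<open>The best score is at least the average score.\<close>
  have "real (card M) * (\<Sum>i\<in>N. of_rat (?f i) * w (?f i)) \<le> real (card M) * score w N M A ?c"
    using sum_bounded_above[of M "score w N M A" "score w N M A ?c"] best
    by (simp add: sum_score[OF inst])
  then have avg: "(\<Sum>i\<in>N. of_rat (?f i) * w (?f i)) \<le> (\<Sum>i\<in>W. w (?f i))"
    using M by (simp add: score_def W_def)
  \<comment> \<open>\<open>G\<close> and \<open>W\<close> are disjoint, and the remaining voters
    contribute nonnegatively. Moving the share of \<open>W\<close> to the other side then turns
    \<open>w f\<close> into \<open>(1 - f) * w f\<close>.\<close>
  have "real (card G) * F \<le> (\<Sum>i\<in>G. of_rat (?f i) * w (?f i))"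
    by (rule sum_bounded_below) (rule gF)
  also have "\<dots> + (\<Sum>i\<in>W. of_rat (?f i) * w (?f i))
      = (\<Sum>i\<in>G \<union> W. of_rat (?f i) * w (?f i))"
    using W finG by (subst sum.union_disjoint) auto
  also have "\<dots> \<le> (\<Sum>i\<in>N. of_rat (?f i) * w (?f i))"
    using W G nn fin by (intro sum_mono2) auto
  also note avg
  finally have "real (card G) * F \<le> (\<Sum>i\<in>W. (1 - of_rat (?f i)) * w (?f i))"
    by (simp add: algebra_simps sum_subtractf)
  also have "\<dots> \<le> real (card W) * P"
    by (rule sum_bounded_above) (rule wP)
  also have "\<dots> \<le> real (card (N - G)) * P"
    using W fin P(2) by (intro mult_right_mono) (auto intro: card_mono)
  also have "real (card (N - G)) = real (card N) - real (card G)"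
    using G fin finG by (simp add: card_Diff_subset card_mono of_nat_diff)
  finally show ?thesis .
qed

section \<open>Cyclic profiles, for the lower bound\<close>

lemma card_cyclic_shift:
  fixes c k d :: nat
  assumes "d \<le> k"
  shows "card {y. y < k \<and> (c + y) mod k < d} = d"
proof (cases "k = 0")
  case True
  then show ?thesis using assms by simp
next
  case False
  \<comment> \<open>Shifting modulo \<open>k\<close> permutes \<open>{..<k}\<close>, so the preimage
    of \<open>{..<d}\<close> has exactly \<open>d\<close> elements. Injectivity is checked over the
    integers, where differences are not truncated.\<close>
  have inj: "inj_on (\<lambda>y. (c + y) mod k) {..<k}"
  proof (rule inj_onI)
    fix x y assume "x \<in> {..<k}" "y \<in> {..<k}" and eq: "(c + x) mod k = (c + y) mod k"
    then have xy: "x < k" "y < k" by auto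
    have "int k dvd int (c + x) - int (c + y)"
      using eq by (metis mod_eq_dvd_iff zmod_int)
    then have "int k dvd int x - int y" by simp
    then show "x = y" using xy
      by (metis mod_eq_dvd_iff mod_less of_nat_eq_iff zmod_int)
  qed
  have img: "(\<lambda>y. (c + y) mod k) ` {..<k} = {..<k}"
    using False by (intro endo_inj_surj inj) auto
  have "card {y. y < k \<and> (c + y) mod k < d}
      = card ((\<lambda>y. (c + y) mod k) ` {y. y < k \<and> (c + y) mod k < d})"
    by (rule card_image[symmetric]) (rule inj_on_subset[OF inj], auto)
  also have "(\<lambda>y. (c + y) mod k) ` {y. y < k \<and> (c + y) mod k < d} = {..<d}"
  proof (intro equalityI subsetI)
    fix z assume z: "z \<in> {..<d}"
    then have "z \<in> (\<lambda>y. (c + y) mod k) ` {..<k}" using img assms by auto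
    then show "z \<in> (\<lambda>y. (c + y) mod k) ` {y. y < k \<and> (c + y) mod k < d}" using z by auto
  qed auto
  finally show ?thesis by simp
qed

lemma obtain_inj_nat:
  obtains e :: "nat \<Rightarrow> 'a::infinite" where "inj e"
  using infinite_countable_subset[OF infinite_UNIV] by blast

text \<open>Voters form a grid of \<open>q\<close> rows of length \<open>k = m - 1\<close>;
  candidates are \<open>0..k\<close>, with \<open>k\<close> the special one. The first
  \<open>p\<close> rows form the group: each voter there approves \<open>b\<close> ordinary
  candidates. In the other rows each voter approves \<open>k\<close> and \<open>a - 1\<close>
  ordinary candidates. The guarantee forces an ordinary winner, whose score is then at least that of
  \<open>k\<close>; this is the claimed inequality.\<close>

lemma guarantee_cyclic_bound:
  fixes R :: "('v::infinite, 'c::infinite) rule" and a b m p q :: nat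
  assumes R: "parameterized_by R w" and g: "guarantees_representation R s r"
    and ab: "0 < a" "a < m" "b < m" and s: "s \<le> real b / real m"
    and pq: "p \<le> q" and r: "r * real q < real p"
  shows "real (q - p) * real (m - a) * w (of_nat a / of_nat m)
    \<le> real p * real b * w (of_nat b / of_nat m)"
proof (cases "p = 0 \<and> q = 0")
  case True
  then show ?thesis using r by simp
next
  case False
  with pq have q: "0 < q" by auto
  define k where "k = m - 1"
  have k: "0 < k" "m = Suc k" using ab by (auto simp: k_def)
  obtain ev0 :: "nat \<Rightarrow> 'v" where ev0: "inj ev0" by (rule obtain_inj_nat)
  \<comment> \<open>Pairing numbers makes the voters indexable by grid positions.\<close>
  define ev where "ev = ev0 \<circ> prod_encode"
  have ev: "inj ev" unfolding ev_def by (intro inj_compose ev0 inj_prod_encode)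
  obtain ec :: "nat \<Rightarrow> 'c" where ec: "inj ec" by (rule obtain_inj_nat)
  \<comment> \<open>A block of \<open>d\<close> cyclically consecutive ordinary candidates,
    translated by \<open>y\<close>. The condition is symmetric in \<open>y\<close> and
    \<open>z\<close>, so the same count gives block sizes and numbers of approvers.\<close>
  define B where "B = (\<lambda>d y. {z. z < k \<and> (y + z) mod k < d})"
  define S where "S = (\<lambda>(x, y). if x < p then B b y else insert k (B (a - 1) y))"
  define I where "I = {..<q} \<times> {..<k}"
  define N where "N = ev ` I"
  define M where "M = ec ` {..k}"
  define A where "A = (\<lambda>i. if i \<in> N then ec ` S (inv ev i) else {})"
  define G where "G = ev ` ({..<p} \<times> {..<k})"
  have cardB: "card (B d y) = d" if "d \<le> k" for d y
    unfolding B_def using that by (rule card_cyclic_shift)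
  have finB: "finite (B d y)" for d y unfolding B_def by simp
  have cardS: "card (S (x, y)) = (if x < p then b else a)" for x y
  proof -
    have "k \<notin> B (a - 1) y" by (simp add: B_def)
    then show ?thesis using ab k by (auto simp: S_def cardB finB)
  qed
  have A: "A (ev v) = ec ` S v" if "v \<in> I" for v
    using that ev by (auto simp: A_def N_def)
  have cM: "card M = m" unfolding M_def using ec k
    by (simp add: card_image inj_on_subset[OF ec])
  have inst: "approval_instance N M A"
    unfolding approval_instance_def
  proof (intro conjI ballI allI impI)
    show "finite N" "N \<noteq> {}" "finite M" "M \<noteq> {}"
      using q k by (auto simp: N_def M_def I_def)
    show "A i \<subseteq> M" if i: "i \<in> N" for i
    proof -
      obtain v where v: "v \<in> I" "i = ev v" using i by (auto simp: N_def)
      have "S v \<subseteq> {..k}" by (cases v) (auto simp: S_def B_def)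
      then show ?thesis using v by (auto simp: A M_def)
    qed
    show "A i = {}" if "i \<notin> N" for i using that by (simp add: A_def)
  qed
  define W where "W = (\<lambda>x. if x < p then w (of_nat b / of_nat m) else w (of_nat a / of_nat m))"
  have flexi: "flexibility M A (ev (x, y)) = of_nat (if x < p then b else a) / of_nat m"
    if "(x, y) \<in> I" for x y
    using that by (simp add: flexibility_def A cM card_image inj_on_subset[OF ec] cardS)
  have memA: "ec c \<in> A (ev v) \<longleftrightarrow> c \<in> S v" if "v \<in> I" for c v
    using that ec by (auto simp: A inj_eq)
  have score: "score w N M A (ec c) = (\<Sum>x<q. W x * real (card {y. y < k \<and> c \<in> S (x, y)}))"
    for c
  proof -
    have sup: "supporters N A (ec c) = ev ` {v \<in> I. c \<in> S v}"
      unfolding supporters_def N_def using memA by auto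
    have "score w N M A (ec c) = (\<Sum>v\<in>{v \<in> I. c \<in> S v}. w (flexibility M A (ev v)))"
      unfolding score_def sup
      by (subst sum.reindex) (auto intro: inj_on_subset[OF ev])
    also have "\<dots> = (\<Sum>v\<in>{v \<in> I. c \<in> S v}. W (fst v))"
      by (intro sum.cong) (auto simp: flexi W_def)
    \<comment> \<open>The weight depends only on the row, so approvers are counted row by
      row.\<close>
    also have "{v \<in> I. c \<in> S v} = Sigma {..<q} (\<lambda>x. {y. y < k \<and> c \<in> S (x, y)})"
      by (auto simp: I_def)
    also have "(\<Sum>v\<in>\<dots>. W (fst v)) = (\<Sum>x<q. \<Sum>y | y < k \<and> c \<in> S (x, y). W x)"
      by (subst sum.Sigma) (auto simp: case_prod_beta)
    finally show ?thesis by (simp add: mult.commute)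
  qed
  have split: "(\<Sum>x<q. if x < p then X else Y) = real p * X + real (q - p) * Y" for X Y :: real
  proof -
    have "{..<q} \<inter> {x. x < p} = {..<p}" "{..<q} \<inter> - {x. x < p} = {p..<q}" using pq by auto
    then show ?thesis by (simp add: sum.If_cases)
  qed
  have score_k: "score w N M A (ec k) = real (q - p) * real k * w (of_nat a / of_nat m)"
  proof -
    have "score w N M A (ec k)
        = (\<Sum>x<q. if x < p then 0 else real k * w (of_nat a / of_nat m))"
      unfolding score by (intro sum.cong) (auto simp: W_def S_def B_def)
    then show ?thesis by (simp add: split)
  qed
  have score_c: "score w N M A (ec c)
      = real p * real b * w (of_nat b / of_nat m)
        + real (q - p) * real (a - 1) * w (of_nat a / of_nat m)" if c: "c < k" for c
  proof -
    \<comment> \<open>The roles of shift and candidate are exchanged: within a row, \<open>c\<close>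
      lies in exactly \<open>d\<close> of the \<open>k\<close> blocks.\<close>
    have *: "card {y. y < k \<and> (y + c) mod k < d} = d" if "d \<le> k" for d
      using card_cyclic_shift[OF that, of c] by (simp add: add.commute)
    have "score w N M A (ec c)
        = (\<Sum>x<q. if x < p then real b * w (of_nat b / of_nat m)
                  else real (a - 1) * w (of_nat a / of_nat m))"
      unfolding score using c ab k by (intro sum.cong) (auto simp: W_def S_def B_def *)
    then show ?thesis by (simp add: split)
  qed
  have GN: "G \<subseteq> N" using pq by (auto simp: G_def N_def I_def)
  \<comment> \<open>All rows have length \<open>k\<close>, so the group is the fraction
    \<open>p / q\<close> of the voters.\<close>
  have cards: "card G = p * k" "card N = q * k"
    by (simp_all add: G_def N_def I_def card_image inj_on_subset[OF ev] card_cartesian_product)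
  have "r * real (card N) < real (card G)"
    using mult_strict_right_mono[OF r, of "real k"] k by (simp add: cards mult.assoc)
  moreover have "flexible M A s i" if i: "i \<in> G" for i
  proof -
    obtain x y where xy: "i = ev (x, y)" "x < p" "y < k" using i by (auto simp: G_def)
    then have "(x, y) \<in> I" using pq by (auto simp: I_def)
    then show ?thesis using s xy by (simp add: flexible_def flexi of_rat_divide)
  qed
  ultimately obtain i where i: "i \<in> G" "R N M A \<in> A i"
    using g inst GN unfolding guarantees_representation_def by meson
  obtain x y where xy: "i = ev (x, y)" "x < p" "(x, y) \<in> I"
    using i(1) pq by (auto simp: G_def I_def)
  \<comment> \<open>Members of \<open>G\<close> approve ordinary candidates only, so the winner is
    not \<open>k\<close>.\<close>
  obtain c where c: "R N M A = ec c" "c < k"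
    using i(2) xy by (auto simp: A S_def B_def)
  have "ec k \<in> M" by (simp add: M_def)
  then have "score w N M A (ec k) \<le> score w N M A (ec c)"
    using R inst c(1) unfolding parameterized_by_def by metis
  \<comment> \<open>In each row outside the group, \<open>k\<close> has this many more approvers
    than an ordinary candidate.\<close>
  moreover have "real k - real (a - 1) = real (m - a)" using ab k by auto
  ultimately show ?thesis
    by (simp add: score_k score_c[OF c(2)] flip: \<open>real k - real (a - 1) = real (m - a)\<close>)
      (simp add: algebra_simps)
qed

text \<open>Both flexibilities must be realised with the same number of candidates, hence the single
  denominator.\<close>

lemma rat_common_denominator:
  fixes f g :: rat
  assumes "0 < f" "f < 1" "0 < g" "g < 1"
  obtains a b m :: nat where "0 < a" "a < m" "0 < b" "b < m"
    "f = of_nat a / of_nat m" "g = of_nat b / of_nat m"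
proof -
  have frac: "\<exists>a d::nat. 0 < d \<and> x = of_nat a / of_nat d" if "0 < x" for x :: rat
  proof -
    obtain a d where ad: "quotient_of x = (a, d)" by fastforce
    have "x = of_int a / of_int d" "0 < d"
      using quotient_of_div[OF ad] quotient_of_denom_pos[OF ad] by auto
    moreover from this that have "0 < a" by (simp add: zero_less_divide_iff)
    ultimately have "0 < nat d" "x = of_nat (nat a) / of_nat (nat d)" by auto
    then show ?thesis by blast
  qed
  obtain a d where ad: "0 < d" "f = of_nat a / of_nat d" using frac assms by blast
  obtain b e where be: "0 < e" "g = of_nat b / of_nat e" using frac assms by blast
  have "f = of_nat (a * e) / of_nat (d * e)" "g = of_nat (b * d) / of_nat (d * e)"
    using ad be by auto
  moreover from this assms have "0 < a * e" "a * e < d * e" "0 < b * d" "b * d < d * e"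
    using ad be by (auto simp: zero_less_divide_iff intro: gr0I)
  ultimately show ?thesis using that by blast
qed

text \<open>If the inequality failed, \<open>r\<close> would lie strictly below
  \<open>P / (P + F)\<close>. A rational \<open>t = p / q\<close> in the gap is a group proportion
  above \<open>r\<close> for which the cyclic profile gives a contradiction.\<close>

lemma guarantee_lower_bound:
  fixes R :: "('v::infinite, 'c::infinite) rule"
  assumes w: "weight_function w" and R: "parameterized_by R w"
    and g: "guarantees_representation R s r" and r: "0 \<le> r" "r \<le> 1"
    and f: "0 < f" "f < 1" and h: "0 < h" "h < 1" "s \<le> of_rat h"
  shows "(1 - r) * ((1 - of_rat f) * w f) \<le> r * (of_rat h * w h)"
proof (rule ccontr)
  define P where "P = (1 - of_rat f) * w f"
  define F where "F = of_rat h * w h"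
  assume "\<not> ?thesis"
  then have less: "r * F < (1 - r) * P" by (simp add: P_def F_def)
  have F: "0 \<le> F" using w h by (auto simp: F_def weight_function_def)
  have P0: "0 < P"
  proof -
    have "0 < (1 - r) * P" using less r F by (smt (verit) mult_nonneg_nonneg)
    then show ?thesis using r by (simp add: zero_less_mult_iff)
  qed
  have "r < P / (P + F)" using less P0 F by (simp add: field_simps)
  then obtain t where t: "r < of_rat t" "of_rat t < P / (P + F)" using of_rat_dense by blast
  have tP: "of_rat t * F < (1 - of_rat t) * P" using t(2) P0 F by (simp add: field_simps)
  have "(0::real) < of_rat t" using t r by linarith
  then have t0: "0 < t" by simp
  have "P / (P + F) \<le> 1" using P0 F by simp
  then have "(of_rat t :: real) < 1" using t by linarith
  then have t1: "t < 1" by simp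
  \<comment> \<open>Applied to \<open>t\<close> twice, merely to write it as a fraction of
    naturals.\<close>
  obtain p p' q :: nat where pq: "0 < p" "p < q" "t = of_nat p / of_nat q"
    using rat_common_denominator[OF t0 t1 t0 t1] by metis
  obtain a b m :: nat where ab: "0 < a" "a < m" "0 < b" "b < m"
    "f = of_nat a / of_nat m" "h = of_nat b / of_nat m"
    using rat_common_denominator[OF f h(1,2)] by metis
  have m: "0 < real m" and q: "0 < real q" using ab pq by auto
  have tr: "of_rat t = real p / real q" using pq by (simp add: of_rat_divide)
  have fr: "of_rat f = real a / real m" using ab by (simp add: of_rat_divide)
  have hr: "of_rat h = real b / real m" using ab by (simp add: of_rat_divide)
  have "real (q - p) * real (m - a) * w f \<le> real p * real b * w h"
    unfolding ab(5,6)
  proof (rule guarantee_cyclic_bound[OF R g])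
    show "s \<le> real b / real m" using h(3) hr by simp
    show "r * real q < real p" using t(1) q by (simp add: tr field_simps)
  qed (use ab(1,2,4) pq(2) in auto)
  moreover have "real (q - p) = real q * (1 - of_rat t)" "real (m - a) = real m * (1 - of_rat f)"
    using ab(2) pq(2) m q by (simp_all add: tr fr of_nat_diff right_diff_distrib)
  then have "real (q - p) * real (m - a) * w f = real q * real m * ((1 - of_rat t) * P)"
    by (simp add: P_def)
  moreover have "real p * real b * w h = real q * real m * (of_rat t * F)"
    using m q by (simp add: tr hr F_def)
  ultimately have "(1 - of_rat t) * P \<le> of_rat t * F" using m q by simp
  then show False using tP by linarith
qed

section \<open>From the two bounds to the formula\<close>

lemma FVR_eq:
  fixes R :: "('v::infinite, 'c::infinite) rule"
  assumes w: "weight_function w" and nt: "nontrivial w" and R: "parameterized_by R w"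
    and s: "0 < s" "s < 1"
  shows "ereal (FVR R s) = ratio (rho w) (phi w s)"
proof -
  let ?r = "FVR R s"
  have r: "0 \<le> ?r" "?r \<le> 1" and g: "guarantees_representation R s ?r"
    using FVR_minimum(1)[of R s] by auto
  have lower: "(1 - ?r) * ((1 - of_rat f) * w f) \<le> ?r * (of_rat h * w h)"
    if "0 < f" "f < 1" "0 < h" "h < 1" "s \<le> of_rat h" for f h
    using guarantee_lower_bound[OF w R g r that] .
  \<comment> \<open>This \<open>h\<close> shows that the infimum ranges over a nonempty set, so
    \<open>phi w s\<close> is finite; it also serves as a fixed second flexibility below.\<close>
  obtain h where h: "s < of_rat h" "of_rat h < (1::real)" using of_rat_dense[OF s(2)] by blast
  have "(0::real) < of_rat h" using h s by linarith
  then have h': "0 < h" "h < 1" "s \<le> of_rat h" using h by auto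
  have wnn: "0 \<le> w f" if "0 < f" "f < 1" for f using w that by (auto simp: weight_function_def)
  obtain f where f: "0 < f" "f < 1" "0 < w f" using nt by (auto simp: nontrivial_def)
  have "0 < (1 - of_rat f) * w f" using f by simp
  also have rho_ge: "ereal ((1 - of_rat f) * w f) \<le> rho w" if "0 < f" "f < 1" for f
    unfolding rho_def using that by (intro SUP_upper) auto
  ultimately have rho_pos: "0 < rho w" using f
    by (metis ereal_less(2) order_less_le_trans)
  have phi_le: "phi w s \<le> ereal (of_rat f * w f)" if "0 < f" "f < 1" "s \<le> of_rat f" for f
    unfolding phi_def using that by (intro INF_lower) auto
  have phi_nn: "0 \<le> phi w s"
    unfolding phi_def by (rule INF_greatest) (auto intro!: mult_nonneg_nonneg wnn)
  obtain F where F: "phi w s = ereal F" "0 \<le> F"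
    using phi_nn phi_le[OF h'] by (cases "phi w s") auto
  show ?thesis
  proof (cases "rho w")
    case PInf
    have "?r = 1"
    proof (rule ccontr)
      assume "?r \<noteq> 1"
      then have r1: "?r < 1" using r by simp
      \<comment> \<open>With \<open>h\<close> fixed and \<open>?r < 1\<close>, the lower bound caps
        all terms of the supremum at once.\<close>
      have "rho w \<le> ereal (?r * (of_rat h * w h) / (1 - ?r))"
        unfolding rho_def
        by (rule SUP_least) (use lower[OF _ _ h'] r1 in \<open>auto simp: field_simps\<close>)
      then show False using PInf by simp
    qed
    then show ?thesis using PInf by (simp add: ratio_def one_ereal_def)
  next
    case MInf
    then show ?thesis using rho_pos by simp
  next
    case (real P)
    have P: "0 < P" using rho_pos real by simp
    have "?r \<le> P / (P + F)"
    proof (rule FVR_minimum(2))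
      show "0 \<le> P / (P + F)" "P / (P + F) \<le> 1" using P F by auto
      show "guarantees_representation R s (P / (P + F))"
        unfolding guarantees_representation_def
      proof (intro allI impI, rule ccontr)
        fix N M A G
        assume a: "approval_instance N M A" "G \<subseteq> N"
          "P / (P + F) * real (card N) < real (card G)"
          "\<forall>i\<in>G. flexible M A s i" "\<not> (\<exists>i\<in>G. R N M A \<in> A i)"
        have "real (card G) * F \<le> (real (card N) - real (card G)) * P"
          using a(5) P rho_ge phi_le real F
          by (intro unrepresented_group_bound[OF w R a(1,2,4) _ s(1)]) auto
        then show False using a(3) P F by (simp add: field_simps)
      qed
    qed
    moreover have "P / (P + F) \<le> ?r"
    proof -
      \<comment> \<open>The two limits are taken in turn: first the supremum over \<open>f\<close>
        with \<open>h\<close> fixed, dividing by \<open>1 - ?r\<close>, then the infimum over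
        \<open>h\<close>, dividing by \<open>?r\<close>.\<close>
      have *: "(1 - ?r) * P \<le> ?r * (of_rat h * w h)"
        if h: "0 < h" "h < 1" "s \<le> of_rat h" for h
      proof (cases "?r = 1")
        case True
        then show ?thesis using wnn h by simp
      next
        case False
        then have r1: "?r < 1" using r by simp
        have "rho w \<le> ereal (?r * (of_rat h * w h) / (1 - ?r))"
          unfolding rho_def
          by (rule SUP_least) (use lower[OF _ _ h] r1 in \<open>auto simp: field_simps\<close>)
        then show ?thesis using real r1 by (simp add: field_simps)
      qed
      \<comment> \<open>At \<open>?r = 0\<close> the inequality just shown would read
        \<open>P \<le> 0\<close>.\<close>
      have r0: "0 < ?r"
      proof (rule ccontr)
        assume "\<not> 0 < ?r"
        then have "?r = 0" using r by simp
        then show False using *[OF h'] P by simp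
      qed
      have "ereal ((1 - ?r) * P / ?r) \<le> phi w s"
        unfolding phi_def
        by (rule INF_greatest) (use * r0 in \<open>auto simp: field_simps\<close>)
      then have "(1 - ?r) * P \<le> ?r * F" using F r0 by (simp add: field_simps)
      then show ?thesis using P F by (simp add: field_simps)
    qed
    ultimately have "?r = P / (P + F)" by simp
    then show ?thesis using real F P by (simp add: ratio_def)
  qed
qed

text \<open>Both factors are nonnegative and nondecreasing, and \<open>q\<close> itself belongs to
  the range of the infimum because it is rational.\<close>

lemma phi_mono_on:
  assumes w: "weight_function w" and mono: "mono_on {0<..<1} w" and q: "0 < q" "q < 1"
  shows "phi w (of_rat q) = ereal (of_rat q * w q)"
proof (rule antisym)
  show "phi w (of_rat q) \<le> ereal (of_rat q * w q)"
    unfolding phi_def using q by (intro INF_lower) auto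
  show "ereal (of_rat q * w q) \<le> phi w (of_rat q)"
    unfolding phi_def
  proof (rule INF_greatest)
    fix f assume "f \<in> {f \<in> {0<..<1}. (of_rat q :: real) \<le> of_rat f}"
    then have f: "0 < f" "f < 1" "q \<le> f" by (auto simp: of_rat_less_eq)
    then have "w q \<le> w f" using q by (intro mono_onD[OF mono]) auto
    moreover have "0 \<le> w q" using w q by (auto simp: weight_function_def)
    ultimately show "ereal (of_rat q * w q) \<le> ereal (of_rat f * w f)"
      using f q by (auto intro!: mult_mono simp: of_rat_less_eq)
  qed
qed

theorem theorem2p6:
  fixes w :: "rat \<Rightarrow> real" and R :: "('v::infinite, 'c::infinite) rule"
  assumes "weight_function w" and "nontrivial w" and "parameterized_by R w"
  shows "(\<forall>s::real. 0 < s \<and> s < 1 \<longrightarrow> ereal (FVR R s) = ratio (rho w) (phi w s)) \<and>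
    (mono_on {0<..<1} w \<longrightarrow>
      (\<forall>q::rat. 0 < q \<and> q < 1 \<longrightarrow>
        phi w (of_rat q) = ereal (of_rat q * w q) \<and>
        ereal (FVR R (of_rat q)) = ratio (rho w) (ereal (of_rat q * w q))))"
proof (intro conjI allI impI; (elim conjE)?)
  show "ereal (FVR R s) = ratio (rho w) (phi w s)" if "0 < s" "s < 1" for s
    using FVR_eq[OF assms that] .
  fix q :: rat
  assume mono: "mono_on {0<..<1} w" and q: "0 < q" "q < 1"
  show phi: "phi w (of_rat q) = ereal (of_rat q * w q)"
    using phi_mono_on[OF assms(1) mono q] .
  show "ereal (FVR R (of_rat q)) = ratio (rho w) (ereal (of_rat q * w q))"
    using FVR_eq[OF assms, of "of_rat q"] q by (simp add: phi)
qed

end
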